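(* Let $x_1\ge x_2\ge\cdots\ge x_n$ be real numbers with arithmetic mean $\bar x$, let $r$ be a positive integer, and let $m_{2r}$ be their $2r$-th central moment. For $1\le k\le j\le n$ let $x_{(k,j)}=\frac{1}{j-k+1}\sum_{i=k}^{j}x_i$. Then for all $1\le k\le j\le n$, $$\bar{x}-\left(\frac{n(k-1)^{2r-1}m_{2r}}{(n-k+1)^{2r}+(n-k+1)(k-1)^{2r-1}}\right)^{\frac{1}{2r}}\le x_{(k,j)}\le \bar{x}+\left(\frac{n(n-j)^{2r-1}m_{2r}}{j^{2r}+j(n-j)^{2r-1}}\right)^{\frac{1}{2r}}.\qquad( * )$$ If $(k,j)=(1,n)$, the inequality string $( * )$ collapses (all three quantities equal $\bar x$). If $(k,j)\ne(1,n)$, equality holds on the right side of $( * )$ if and only if $x_1=x_2=\cdots=x_j$ and $x_{j+1}=x_{j+2}=\cdots=x_n$, and equality holds on the left side of $( * )$ if and only if $x_1=x_2=\cdots=x_{k-1}$ and $x_k=x_{k+1}=\cdots=x_n$. Furthermore, for $1\le j\le n$, $$\bar{x}-\left(\frac{n(j-1)^{2r-1}m_{2r}}{(n-j+1)^{2r}+(n-j+1)(j-1)^{2r-1}}\right)^{\frac{1}{2r}}\le x_{j}\le \bar{x}+\left(\frac{n(n-j)^{2r-1}m_{2r}}{j^{2r}+j(n-j)^{2r-1}}\right)^{\frac{1}{2r}},$$ with equality on the right side if and only if $x_1=\cdots=x_j$ and $x_{j+1}=\cdots=x_n$, and equality on the left side if and only if $x_1=\cdots=x_{j-1}$ and $x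_j=\cdots=x_n$.
   Context: For real numbers $x_1,\dots,x_n$: $\bar x=\frac1n\sum_{i=1}^n x_i$, and the $s$-th central moment is $m_s=\frac1n\sum_{i=1}^n(x_i-\bar x)^s$. Chains of equalities over an empty index range or a single index are vacuously true. *)

theory Defs
  imports "HOL-Analysis.Analysis"
begin

text \<open>
  A list of real numbers of length \<open>n\<close> is a function \<open>x :: nat \<Rightarrow> real\<close> of which only the
  values \<open>x 1, \<dots>, x n\<close> are used.
\<close>

definition arith_mean :: "nat \<Rightarrow> (nat \<Rightarrow> real) \<Rightarrow> real" where
  "arith_mean n x = (\<Sum>i=1..n. x i) / real n"

definition central_moment :: "nat \<Rightarrow> nat \<Rightarrow> (nat \<Rightarrow> real) \<Rightarrow> real" where
  "central_moment s n x = (\<Sum>i=1..n. (x i - arith_mean n x) ^ s) / real n"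

text \<open>Meant for \<open>1 \<le> k \<le> j\<close>.\<close>

definition block_mean :: "nat \<Rightarrow> nat \<Rightarrow> (nat \<Rightarrow> real) \<Rightarrow> real" where
  "block_mean k j x = (\<Sum>i=k..j. x i) / (real j - real k + 1)"

text \<open>
  In the two bounds below the radicand is nonnegative with positive denominator for
  \<open>r \<ge> 1\<close> and \<open>1 \<le> k, j \<le> n\<close>, so \<open>root (2 * r)\<close> is the \<open>1 / (2r)\<close>-th power.
\<close>

definition lower_bound :: "nat \<Rightarrow> nat \<Rightarrow> (nat \<Rightarrow> real) \<Rightarrow> nat \<Rightarrow> real" where
  "lower_bound r n x k = arith_mean n x -
     root (2 * r)
       (real n * (real k - 1) ^ (2 * r - 1) * central_moment (2 * r) n x /
        ((real n - real k + 1) ^ (2 * r) +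
         (real n - real k + 1) * (real k - 1) ^ (2 * r - 1)))"

definition upper_bound :: "nat \<Rightarrow> nat \<Rightarrow> (nat \<Rightarrow> real) \<Rightarrow> nat \<Rightarrow> real" where
  "upper_bound r n x j = arith_mean n x +
     root (2 * r)
       (real n * (real n - real j) ^ (2 * r - 1) * central_moment (2 * r) n x /
        (real j ^ (2 * r) + real j * (real n - real j) ^ (2 * r - 1)))"

text \<open>
  Chains of equalities \<open>x\<^sub>a = \<dots> = x\<^sub>b\<close> are expressed as \<open>x constant_on {a..b}\<close>, which holds
  trivially when the index range is empty or a singleton.
\<close>

end

theory Submission
  imports Defs
begin

text \<open>
  Split the indices at \<open>j\<close>. By the power mean inequality on either side of the cut, the
  \<open>2r\<close>-th moment is at least that of the two-valued sequence with the same two block means,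
  with equality iff \<open>x\<close> is constant on both blocks. As the deviations of the two block means
  from \<open>\<bar>x\<close> balance, this bounds the mean of \<open>x\<^sub>1, \<dots>, x\<^sub>j\<close>, which dominates the mean of
  \<open>x\<^sub>k, \<dots>, x\<^sub>j\<close> by monotonicity. The left-hand bounds follow by applying the right-hand ones
  to the reversed sequence \<open>i \<mapsto> - x\<^sub>n\<^sub>+\<^sub>1\<^sub>-\<^sub>i\<close>.
\<close>

section \<open>Even powers: tangent and power mean inequalities\<close>

text \<open>With no existential value to track, constancy passes directly through translation,
  negation and reindexing.\<close>

lemma constant_on_iff_pairwise: "f constant_on A \<longleftrightarrow> (\<forall>a\<in>A. \<forall>b\<in>A. f a = f b)"
proof
  assume *: "\<forall>a\<in>A. \<forall>b\<in>A. f a = f b"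
  then show "f constant_on A"
    unfolding constant_on_def by blast
qed (auto simp: constant_on_def)

text \<open>Induction on the exponent: multiplying the inequality for \<open>r\<close> by
  \<open>t \<ge> 0\<close> exceeds the next tangent by exactly
  \<open>r * b ^ (r - 1) * (t - b)\<^sup>2\<close>, which is nonnegative.\<close>

lemma power_ge_tangent:
  fixes t b :: real
  assumes "0 \<le> t" "0 \<le> b"
  shows "b ^ r + real r * b ^ (r - 1) * (t - b) \<le> t ^ r"
proof (induction r)
  case (Suc r)
  have "b ^ Suc r + real (Suc r) * b ^ r * (t - b) \<le> t * (b ^ r + real r * b ^ (r - 1) * (t - b))"
  proof (cases r)
    case (Suc s)
    have "0 \<le> real r * b ^ s * (t - b)\<^sup>2"
      using assms by simp
    then show ?thesis
      unfolding Suc by (simp add: algebra_simps power2_eq_square)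
  qed (simp add: algebra_simps)
  also have "\<dots> \<le> t * t ^ r"
    using Suc.IH assms(1) by (rule mult_left_mono)
  finally show ?case by simp
qed simp

text \<open>Substituting squares in the previous lemma leaves the square \<open>(y - a)\<^sup>2\<close> to spare, which
  makes the inequality strict.\<close>

lemma even_power_gt_tangent:
  fixes y a :: real
  assumes "1 \<le> r" "y \<noteq> a"
  shows "a ^ (2 * r) + 2 * real r * a ^ (2 * r - 1) * (y - a) < y ^ (2 * r)"
\<comment> \<open>The surplus used for \<open>a \<noteq> 0\<close> carries the factor
  \<open>(a\<^sup>2) ^ s\<close>, which may vanish at \<open>a = 0\<close>.\<close>
proof (cases "a = 0")
  case True
  have "2 * r \<noteq> 0" "2 * r - 1 \<noteq> 0"
    using assms(1) by auto
  with True show ?thesis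
    using assms by (simp add: power_0_left zero_less_power_eq)
next
  case False
  obtain s where s: "r = Suc s"
    using assms(1) by (cases r) auto
  have "0 < real r * (a\<^sup>2) ^ s * (y - a)\<^sup>2"
    using assms False by simp
  moreover have "a ^ (2 * r - 1) = (a\<^sup>2) ^ s * a"
    by (simp add: s power_mult)
  moreover have "(a\<^sup>2) ^ r + real r * (a\<^sup>2) ^ s * (y\<^sup>2 - a\<^sup>2) \<le> (y\<^sup>2) ^ r"
    using power_ge_tangent[of "y\<^sup>2" "a\<^sup>2" r] by (simp add: s)
  ultimately show ?thesis
    by (simp add: power_mult algebra_simps power2_eq_square)
qed

text \<open>Sum the tangent inequalities at the mean \<open>a\<close>: the linear terms cancel.
  Strictness away from \<open>a\<close> settles the equality case.\<close>

lemma even_power_mean: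
  fixes y :: "'a \<Rightarrow> real"
  assumes "finite A" "A \<noteq> {}" "1 \<le> r"
  shows "real (card A) * (sum y A / real (card A)) ^ (2 * r) \<le> (\<Sum>i\<in>A. y i ^ (2 * r))" (is ?le)
    and "real (card A) * (sum y A / real (card A)) ^ (2 * r) = (\<Sum>i\<in>A. y i ^ (2 * r))
           \<longleftrightarrow> y constant_on A" (is ?eq)
proof -
  define a where "a = sum y A / real (card A)"
  \<comment> \<open>The gap between the power and its tangent at the mean; it is zero exactly when
    \<open>y i = a\<close>.\<close>
  define g where "g i = y i ^ (2 * r) - (a ^ (2 * r) + 2 * real r * a ^ (2 * r - 1) * (y i - a))" for i
  have card: "real (card A) > 0"
    using assms by (simp add: card_gt_0_iff)
  have g_nonneg: "0 \<le> g i" for i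
    using even_power_gt_tangent[OF assms(3), of "y i" a] by (cases "y i = a") (auto simp: g_def)
  have g_zero: "g i = 0 \<longleftrightarrow> y i = a" for i
    using even_power_gt_tangent[OF assms(3), of "y i" a] by (cases "y i = a") (auto simp: g_def)
  have "(\<Sum>i\<in>A. y i - a) = 0"
    using card by (simp add: sum_subtractf a_def)
  then have sum_g: "sum g A = (\<Sum>i\<in>A. y i ^ (2 * r)) - real (card A) * a ^ (2 * r)"
    by (simp add: g_def sum_subtractf sum.distrib flip: sum_distrib_left)
  show ?le
    using sum_nonneg[of A g] g_nonneg sum_g by (simp add: a_def)
  have "sum g A = 0 \<longleftrightarrow> (\<forall>i\<in>A. y i = a)"
    using assms(1) g_nonneg g_zero by (simp add: sum_nonneg_eq_0_iff)
  also have "\<dots> \<longleftrightarrow> y constant_on A"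
  proof
    assume "y constant_on A"
    then obtain c where c: "\<And>i. i \<in> A \<Longrightarrow> y i = c"
      by (auto simp: constant_on_def)
    then have "a = c"
      using card by (simp add: a_def)
    with c show "\<forall>i\<in>A. y i = a" by simp
  qed (auto simp: constant_on_def)
  finally show ?eq
    using sum_g by (auto simp: a_def)
qed

section \<open>Means of blocks of a decreasing sequence\<close>

text \<open>The difference of the two sides is the double sum of the nonnegative terms
  \<open>x i - x k\<close>. Avoiding quotients lets \<open>A\<close> or \<open>B\<close> be
  empty.\<close>

lemma sum_cut_le:
  fixes x :: "'a \<Rightarrow> real"
  assumes "finite A" "finite B" and le: "\<And>i k. i \<in> A \<Longrightarrow> k \<in> B \<Longrightarrow> x k \<le> x i"
  shows "real (card A) * sum x B \<le> real (card B) * sum x A"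
    and "real (card A) * sum x B = real (card B) * sum x A \<longleftrightarrow> (\<forall>i\<in>A. \<forall>k\<in>B. x i = x k)"
proof -
  have eq: "real (card B) * sum x A - real (card A) * sum x B = (\<Sum>i\<in>A. \<Sum>k\<in>B. x i - x k)"
    by (simp add: sum_subtractf sum_distrib_left)
  have nonneg: "0 \<le> (\<Sum>k\<in>B. x i - x k)" if "i \<in> A" for i
    using le that by (intro sum_nonneg) simp
  then show "real (card A) * sum x B \<le> real (card B) * sum x A"
    using eq sum_nonneg[of A "\<lambda>i. \<Sum>k\<in>B. x i - x k"] by simp
  have "(\<Sum>i\<in>A. \<Sum>k\<in>B. x i - x k) = 0 \<longleftrightarrow> (\<forall>i\<in>A. (\<Sum>k\<in>B. x i - x k) = 0)"
    using assms(1) nonneg by (rule sum_nonneg_eq_0_iff)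
  also have "\<dots> \<longleftrightarrow> (\<forall>i\<in>A. \<forall>k\<in>B. x i - x k = 0)"
    using assms(2) le by (intro ball_cong refl sum_nonneg_eq_0_iff) auto
  finally show "real (card A) * sum x B = real (card B) * sum x A \<longleftrightarrow> (\<forall>i\<in>A. \<forall>k\<in>B. x i = x k)"
    using eq by auto
qed

lemma antimono_on_cut:
  fixes x :: "nat \<Rightarrow> real"
  assumes "antimono_on {1..n} x" "k \<le> j" "j \<le> n"
    and "i \<in> {1..<k}" "l \<in> {k..j}"
  shows "x l \<le> x i"
  by (rule monotone_onD[OF assms(1)]) (use assms(2-) in auto)

text \<open>Read \<open>a\<close> and \<open>b\<close> as sums over blocks of sizes \<open>p\<close>
  and \<open>q\<close>: comparing one block with the union reduces to the cross-multiplied form of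
  \<open>sum_cut_le\<close>. The case \<open>p = 0\<close> covers an empty prefix.\<close>

lemma mediant_iff:
  fixes a b p q :: real
  assumes "0 \<le> p" "0 < q"
  shows "b / q \<le> (a + b) / (p + q) \<longleftrightarrow> p * b \<le> q * a"
    and "b / q = (a + b) / (p + q) \<longleftrightarrow> p * b = q * a"
  using assms by (simp_all add: divide_le_eq frac_eq_eq frac_le_eq field_simps)

lemma arith_mean_eq_block_mean: "arith_mean n x = block_mean 1 n x"
  by (simp add: arith_mean_def block_mean_def)

lemma sum_split_at:
  fixes x :: "nat \<Rightarrow> real"
  assumes "1 \<le> k" "k \<le> Suc j"
  shows "sum x {1..j} = sum x {1..<k} + sum x {k..j}"
proof -
  have "{1..j} = {1..<k} \<union> {k..j}"
    using assms by auto
  then show ?thesis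
    by (subst sum.union_disjoint[symmetric]) auto
qed

text \<open>Prepending entries that dominate the block cannot lower its mean, and keeps it only if
  every prefix entry equals every block entry.\<close>

lemma block_mean_le_initial:
  assumes anti: "antimono_on {1..n} x" and k: "1 \<le> k" "k \<le> j" "j \<le> n"
  shows "block_mean k j x \<le> block_mean 1 j x"
    and "1 < k \<Longrightarrow> block_mean k j x = block_mean 1 j x \<longleftrightarrow> x constant_on {1..j}"
proof -
  have card: "real (card {1..<k}) = real k - 1" "real (card {k..j}) = real j - real k + 1"
    using k by (simp_all add: of_nat_diff)
  note cut = sum_cut_le[of "{1..<k}" "{k..j}" x, OF finite_atLeastLessThan finite_atLeastAtMost
      antimono_on_cut[OF anti k(2,3)], unfolded card]
  have mean: "block_mean 1 j x
      = (sum x {1..<k} + sum x {k..j}) / ((real k - 1) + (real j - real k + 1))"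
    using sum_split_at[of k j x] k by (simp add: block_mean_def)
  have pos: "0 \<le> real k - 1" "0 < real j - real k + 1"
    using k by simp_all
  show "block_mean k j x \<le> block_mean 1 j x"
    unfolding mean unfolding block_mean_def mediant_iff[OF pos] by (rule cut(1))
  assume "1 < k"
  have "block_mean k j x = block_mean 1 j x \<longleftrightarrow> (\<forall>i\<in>{1..<k}. \<forall>l\<in>{k..j}. x i = x l)"
    unfolding mean unfolding block_mean_def mediant_iff[OF pos] by (rule cut(2))
  also have "\<dots> \<longleftrightarrow> x constant_on {1..j}"
  proof
    assume *: "\<forall>i\<in>{1..<k}. \<forall>l\<in>{k..j}. x i = x l"
    \<comment> \<open>The indices \<open>1\<close> and \<open>k\<close> represent the two sides of
      the cut: an entry before \<open>k\<close> is linked to \<open>x 1\<close> through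
      \<open>x k\<close>.\<close>
    have "x i = x 1" if "i \<in> {1..j}" for i
    proof (cases "i < k")
      case True
      then have "i \<in> {1..<k}" "1 \<in> {1..<k}" "k \<in> {k..j}"
        using that \<open>1 < k\<close> k by auto
      with * show ?thesis by metis
    next
      case False
      then have "i \<in> {k..j}" "1 \<in> {1..<k}"
        using that \<open>1 < k\<close> by auto
      with * show ?thesis by metis
    qed
    then show "x constant_on {1..j}"
      unfolding constant_on_def by blast
  next
    assume "x constant_on {1..j}"
    moreover have "{1..<k} \<subseteq> {1..j}" "{k..j} \<subseteq> {1..j}"
      using k by auto
    ultimately show "\<forall>i\<in>{1..<k}. \<forall>l\<in>{k..j}. x i = x l"
      unfolding constant_on_iff_pairwise by blast
  qed
  finally show "block_mean k j x = block_mean 1 j x \<longleftrightarrow> x constant_on {1..j}" .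
qed

text \<open>Appending the smaller tail cannot raise the mean. This gives the sign of the deviation
  that the even root later needs.\<close>

lemma arith_mean_le_initial:
  assumes anti: "antimono_on {1..n} x" and j: "1 \<le> j" "j \<le> n"
  shows "arith_mean n x \<le> block_mean 1 j x"
proof (cases "j = n")
  case False
  have "Suc j \<le> n"
    using False j by simp
  from sum_cut_le(1)[of "{1..<Suc j}" "{Suc j..n}" x, OF _ _ antimono_on_cut[OF anti this]]
  have "real j * sum x {Suc j..n} \<le> (real n - real j) * sum x {1..j}"
    using j by (simp add: of_nat_diff atLeastLessThanSuc_atLeastAtMost)
  moreover have "sum x {1..n} = sum x {1..j} + sum x {Suc j..n}"
    using sum_split_at[of "Suc j" n x] j by (simp add: atLeastLessThanSuc_atLeastAtMost)
  ultimately show ?thesis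
    using j by (simp add: arith_mean_def block_mean_def divide_simps algebra_simps)
qed (simp add: arith_mean_eq_block_mean)

section \<open>The upper bound for block means\<close>

text \<open>The deviations from the mean sum to \<open>j * a\<close> up to \<open>j\<close> and to
  \<open>- (j * a)\<close> after it. The power mean inequality on both sides bounds the moment
  below; multiplying by \<open>(n - j) ^ (2 * r - 1)\<close> clears the denominators and yields
  \<open>D\<close> and \<open>E\<close>.\<close>

lemma initial_deviation_power:
  fixes x :: "nat \<Rightarrow> real"
  assumes j: "1 \<le> j" "j < n" and r: "1 \<le> r"
  defines "a \<equiv> block_mean 1 j x - arith_mean n x"
    and "D \<equiv> real j ^ (2 * r) + real j * (real n - real j) ^ (2 * r - 1)"
    and "E \<equiv> real n * (real n - real j) ^ (2 * r - 1) * central_moment (2 * r) n x"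
  shows "a ^ (2 * r) * D \<le> E"
    and "a ^ (2 * r) * D = E \<longleftrightarrow> x constant_on {1..j} \<and> x constant_on {j + 1..n}"
proof -
  define y where "y i = x i - arith_mean n x" for i
  define d where "d = real n - real j"
  have d: "d > 0" "real (n - j) = d"
    using j by (auto simp: d_def of_nat_diff)
  have split: "sum f {1..n} = sum f {1..j} + sum f {j + 1..n}" for f :: "nat \<Rightarrow> real"
    using sum_split_at[of "Suc j" n f] j by (simp add: atLeastLessThanSuc_atLeastAtMost)
  have const: "y constant_on S \<longleftrightarrow> x constant_on S" for S
    by (simp add: constant_on_iff_pairwise y_def)
  have "sum y {1..n} = 0"
    using j by (simp add: y_def sum_subtractf arith_mean_def)
  moreover have A: "sum y {1..j} = real j * a"
    using j by (simp add: y_def a_def sum_subtractf block_mean_def field_simps)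
  ultimately have B: "sum y {j + 1..n} = - (real j * a)"
    using split[of y] by simp
  note P = even_power_mean[of "{1..j}" r y] and Q = even_power_mean[of "{j + 1..n}" r y]
  \<comment> \<open>\<open>?P\<close> and \<open>?Q\<close> are the power sums of the two-valued
    sequence; the even exponent removes the sign of the tail mean.\<close>
  let ?P = "real j * a ^ (2 * r)" and ?Q = "d * (real j * a / d) ^ (2 * r)"
  let ?SP = "\<Sum>i\<in>{1..j}. y i ^ (2 * r)" and ?SQ = "\<Sum>i\<in>{j + 1..n}. y i ^ (2 * r)"
  have P: "?P \<le> ?SP" "?P = ?SP \<longleftrightarrow> x constant_on {1..j}"
    using P j r A by (simp_all add: const)
  have Q: "?Q \<le> ?SQ" "?Q = ?SQ \<longleftrightarrow> x constant_on {j + 1..n}"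
    using Q j r B d by (simp_all add: const)
  have "E = d ^ (2 * r - 1) * (?SP + ?SQ)"
    using j unfolding split[of "\<lambda>i. y i ^ (2 * r)", symmetric]
    by (simp add: E_def central_moment_def d_def y_def)
  moreover have "a ^ (2 * r) * D = d ^ (2 * r - 1) * (?P + ?Q)"
  proof -
    have "d ^ (2 * r) = d * d ^ (2 * r - 1)"
      using r by (metis mult_eq_0_iff not_one_le_zero power_eq_if zero_neq_numeral)
    then show ?thesis
      using d(1) by (simp add: D_def d_def[symmetric] power_divide power_mult_distrib field_simps)
  qed
  moreover have "d ^ (2 * r - 1) > 0"
    using d by simp
  ultimately have "a ^ (2 * r) * D \<le> E \<longleftrightarrow> ?P + ?Q \<le> ?SP + ?SQ"
    "a ^ (2 * r) * D = E \<longleftrightarrow> ?P + ?Q = ?SP + ?SQ"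
    by (simp_all only: mult_le_cancel_left_pos mult_cancel_left less_imp_neq[symmetric] simp_thms)
  \<comment> \<open>Two inequalities in the same direction add up to an equality only if both are
    equalities.\<close>
  moreover have "?P + ?Q = ?SP + ?SQ \<longleftrightarrow> ?P = ?SP \<and> ?Q = ?SQ"
    using P(1) Q(1) by linarith
  ultimately show "a ^ (2 * r) * D \<le> E"
    and "a ^ (2 * r) * D = E \<longleftrightarrow> x constant_on {1..j} \<and> x constant_on {j + 1..n}"
    using P(1) Q(1) unfolding P(2) Q(2) by (simp_all only: add_mono)
qed

lemma upper_bound_at_n: "1 \<le> n \<Longrightarrow> 1 \<le> r \<Longrightarrow> upper_bound r n x n = arith_mean n x"
  by (simp add: upper_bound_def power_0_left)

lemma initial_mean_le_upper_bound:
  assumes anti: "antimono_on {1..n} x" and j: "1 \<le> j" "j < n" and r: "1 \<le> r"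
  shows "block_mean 1 j x \<le> upper_bound r n x j"
    and "block_mean 1 j x = upper_bound r n x j \<longleftrightarrow> x constant_on {1..j} \<and> x constant_on {j + 1..n}"
proof -
  define a where "a = block_mean 1 j x - arith_mean n x"
  define D where "D = real j ^ (2 * r) + real j * (real n - real j) ^ (2 * r - 1)"
  define E where "E = real n * (real n - real j) ^ (2 * r - 1) * central_moment (2 * r) n x"
  note dev = initial_deviation_power[OF j r, of x, folded a_def D_def E_def]
  \<comment> \<open>An even root of \<open>a ^ (2 * r)\<close> recovers only the absolute value of
    \<open>a\<close>.\<close>
  have "a \<ge> 0"
    using arith_mean_le_initial[OF anti, of j] j by (simp add: a_def)
  then have root: "root (2 * r) (a ^ (2 * r)) = a"
    using r by (simp add: real_root_power_cancel)
  have "D > 0"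
    using j by (simp add: D_def add_pos_pos)
  have ub: "upper_bound r n x j = arith_mean n x + root (2 * r) (E / D)"
    by (simp add: upper_bound_def D_def E_def)
  have "root (2 * r) (a ^ (2 * r)) \<le> root (2 * r) (E / D)"
    using dev(1) \<open>D > 0\<close> r by (simp add: field_simps)
  then show "block_mean 1 j x \<le> upper_bound r n x j"
    using root ub by (simp add: a_def)
  have "block_mean 1 j x = upper_bound r n x j \<longleftrightarrow> root (2 * r) (a ^ (2 * r)) = root (2 * r) (E / D)"
    unfolding root ub by (auto simp: a_def)
  also have "\<dots> \<longleftrightarrow> a ^ (2 * r) * D = E"
    using \<open>D > 0\<close> r by (simp add: field_simps)
  finally show "block_mean 1 j x = upper_bound r n x j \<longleftrightarrow> x constant_on {1..j} \<and> x constant_on {j + 1..n}"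
    using dev(2) by simp
qed

text \<open>The mean of the first \<open>j\<close> entries lies between the block mean and the
  bound, so equality requires equality in both comparisons.\<close>

lemma block_mean_le_upper_bound:
  assumes anti: "antimono_on {1..n} x" and k: "1 \<le> k" "k \<le> j" "j \<le> n" and r: "1 \<le> r"
  shows "block_mean k j x \<le> upper_bound r n x j"
    and "(k, j) \<noteq> (1, n) \<Longrightarrow> block_mean k j x = upper_bound r n x j
           \<longleftrightarrow> x constant_on {1..j} \<and> x constant_on {j + 1..n}"
proof -
  note le = block_mean_le_initial[OF anti k]
  have ub: "block_mean 1 j x \<le> upper_bound r n x j"
    using initial_mean_le_upper_bound(1)[OF anti _ _ r, of j] k r
    by (cases "j = n") (auto simp: upper_bound_at_n arith_mean_eq_block_mean)
  with le(1) show "block_mean k j x \<le> upper_bound r n x j"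
    by linarith
  assume ne: "(k, j) \<noteq> (1, n)"
  show "block_mean k j x = upper_bound r n x j \<longleftrightarrow> x constant_on {1..j} \<and> x constant_on {j + 1..n}"
  proof (cases "j = n")
    \<comment> \<open>Here the bound is the overall mean, \<open>k > 1\<close>, and the tail is
      empty, so the equality case of the first comparison decides.\<close>
    case True
    with ne k le(2) r show ?thesis
      by (auto simp: upper_bound_at_n arith_mean_eq_block_mean constant_on_def)
  next
    case False
    then have eq: "block_mean 1 j x = upper_bound r n x j
        \<longleftrightarrow> x constant_on {1..j} \<and> x constant_on {j + 1..n}"
      using initial_mean_le_upper_bound(2)[OF anti _ _ r, of j] k by simp
    show ?thesis
    proof (cases "k = 1")
      \<comment> \<open>Equality in the first comparison means constancy up to \<open>j\<close>,
        which is already half of the condition in \<open>eq\<close>.\<close>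
      case False
      with k le eq ub show ?thesis by fastforce
    qed (use eq in simp)
  qed
qed

section \<open>Reversal with change of sign, and the lower bound\<close>

lemma sum_reverse:
  fixes f :: "nat \<Rightarrow> real"
  assumes "1 \<le> k" "k \<le> j" "j \<le> n"
  shows "(\<Sum>i=n + 1 - j..n + 1 - k. f (n + 1 - i)) = (\<Sum>i=k..j. f i)"
  by (rule sum.reindex_bij_witness[of _ "\<lambda>i. n + 1 - i" "\<lambda>i. n + 1 - i"]) (use assms in auto)

lemma constant_on_reverse:
  fixes x :: "nat \<Rightarrow> real"
  shows "(\<lambda>i. - x (n + 1 - i)) constant_on A \<longleftrightarrow> x constant_on (\<lambda>i. n + 1 - i) ` A"
  by (simp add: constant_on_iff_pairwise)

lemma image_reverse_interval:
  fixes k j n :: nat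
  assumes "k \<le> n + 1" "j \<le> n + 1"
  shows "(\<lambda>i. n + 1 - i) ` {k..j} = {n + 1 - j..n + 1 - k}"
proof -
  have "i \<in> (\<lambda>i. n + 1 - i) ` {k..j}" if "i \<in> {n + 1 - j..n + 1 - k}" for i
    using assms that by (intro image_eqI[of _ _ "n + 1 - i"]) auto
  then show ?thesis by auto
qed

lemma antimono_on_reverse:
  fixes x :: "nat \<Rightarrow> real"
  assumes "antimono_on {1..n} x"
  shows "antimono_on {1..n} (\<lambda>i. - x (n + 1 - i))"
proof (rule monotone_onI)
  fix i l assume "i \<in> {1..n}" "l \<in> {1..n}" "i \<le> l"
  then have "x (n + 1 - i) \<le> x (n + 1 - l)"
    by (intro monotone_onD[OF assms]) auto
  then show "- x (n + 1 - l) \<le> - x (n + 1 - i)" by simp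
qed

lemma block_mean_reverse:
  assumes "1 \<le> k" "k \<le> j" "j \<le> n"
  shows "block_mean (n + 1 - j) (n + 1 - k) (\<lambda>i. - x (n + 1 - i)) = - block_mean k j x"
  using sum_reverse[OF assms, of x] assms
  by (simp add: block_mean_def sum_negf of_nat_diff algebra_simps)

lemma arith_mean_reverse: "1 \<le> n \<Longrightarrow> arith_mean n (\<lambda>i. - x (n + 1 - i)) = - arith_mean n x"
  using block_mean_reverse[of 1 n n x] by (simp add: arith_mean_eq_block_mean)

lemma central_moment_reverse:
  assumes "1 \<le> n"
  shows "central_moment (2 * r) n (\<lambda>i. - x (n + 1 - i)) = central_moment (2 * r) n x"
proof -
  have "(- a - - b) ^ (2 * r) = (a - b) ^ (2 * r)" for a b :: real
    by (simp add: power_mult power2_commute)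
  then show ?thesis
    using sum_reverse[of 1 n n "\<lambda>i. (x i - arith_mean n x) ^ (2 * r)"] assms
    unfolding central_moment_def arith_mean_reverse[OF assms] by simp
qed

text \<open>Putting \<open>j = n + 1 - k\<close> turns the weights \<open>j\<close> and
  \<open>n - j\<close> into \<open>n - k + 1\<close> and \<open>k - 1\<close>, those of the lower
  bound; the even moment is unchanged.\<close>

lemma upper_bound_reverse:
  assumes "1 \<le> k" "k \<le> n"
  shows "upper_bound r n (\<lambda>i. - x (n + 1 - i)) (n + 1 - k) = - lower_bound r n x k"
proof -
  have "1 \<le> n"
    using assms by simp
  have k: "real (n + 1 - k) = real n - real k + 1" "real n - (real n - real k + 1) = real k - 1"
    using assms by (simp_all add: of_nat_diff)
  show ?thesis
    unfolding upper_bound_def lower_bound_def arith_mean_reverse[OF \<open>1 \<le> n\<close>]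
      central_moment_reverse[OF \<open>1 \<le> n\<close>] k by simp
qed

lemma block_mean_ge_lower_bound:
  assumes anti: "antimono_on {1..n} x" and k: "1 \<le> k" "k \<le> j" "j \<le> n" and r: "1 \<le> r"
  shows "lower_bound r n x k \<le> block_mean k j x"
    and "(k, j) \<noteq> (1, n) \<Longrightarrow> lower_bound r n x k = block_mean k j x
           \<longleftrightarrow> x constant_on {1..k - 1} \<and> x constant_on {k..n}"
proof -
  have idx: "1 \<le> n + 1 - j" "n + 1 - j \<le> n + 1 - k" "n + 1 - k \<le> n"
    using k by auto
  note ub = block_mean_le_upper_bound[OF antimono_on_reverse[OF anti] idx r]
  have ubr: "upper_bound r n (\<lambda>i. - x (n + 1 - i)) (n + 1 - k) = - lower_bound r n x k"
    using k by (intro upper_bound_reverse) auto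
  note bmr = block_mean_reverse[OF k, of x]
  show "lower_bound r n x k \<le> block_mean k j x"
    using ub(1) unfolding ubr bmr by simp
  assume ne: "(k, j) \<noteq> (1, n)"
  then have "(n + 1 - j, n + 1 - k) \<noteq> (1, n)"
    using k by auto
  note eq = ub(2)[OF this, unfolded ubr bmr]
  have "(\<lambda>i. n + 1 - i) ` {1..n + 1 - k} = {k..n}"
    using k image_reverse_interval[of 1 n "n + 1 - k"] by simp
  then have "(\<lambda>i. - x (n + 1 - i)) constant_on {1..n + 1 - k} \<longleftrightarrow> x constant_on {k..n}"
    unfolding constant_on_reverse by (rule arg_cong)
  \<comment> \<open>For \<open>k = 1\<close> the left end is \<open>n + 1\<close> and both intervals
    are empty.\<close>
  moreover have "(\<lambda>i. n + 1 - i) ` {n + 1 - k + 1..n} = {1..k - 1}"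
    using k image_reverse_interval[of "n + 1 - k + 1" n n] by (simp add: Suc_diff_le)
  then have "(\<lambda>i. - x (n + 1 - i)) constant_on {n + 1 - k + 1..n} \<longleftrightarrow> x constant_on {1..k - 1}"
    unfolding constant_on_reverse by (rule arg_cong)
  ultimately show "lower_bound r n x k = block_mean k j x
      \<longleftrightarrow> x constant_on {1..k - 1} \<and> x constant_on {k..n}"
    using eq by auto
qed

section \<open>Blocks and single entries combined\<close>

lemma block_mean_singleton: "block_mean j j x = x j"
  by (simp add: block_mean_def)

theorem theorem2p1:
  fixes x :: "nat \<Rightarrow> real" and n r :: nat
  assumes "1 \<le> n" and "1 \<le> r"
    and "antimono_on {1..n} x"
  shows
    "(\<forall>k j. 1 \<le> k \<and> k \<le> j \<and> j \<le> n \<longrightarrow>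
        lower_bound r n x k \<le> block_mean k j x \<and>
        block_mean k j x \<le> upper_bound r n x j \<and>
        ((k, j) = (1, n) \<longrightarrow>
           lower_bound r n x k = arith_mean n x \<and>
           block_mean k j x = arith_mean n x \<and>
           upper_bound r n x j = arith_mean n x) \<and>
        ((k, j) \<noteq> (1, n) \<longrightarrow>
           (block_mean k j x = upper_bound r n x j \<longleftrightarrow>
              x constant_on {1..j} \<and> x constant_on {j + 1..n}) \<and>
           (lower_bound r n x k = block_mean k j x \<longleftrightarrow>
              x constant_on {1..k - 1} \<and> x constant_on {k..n})))
     \<and>
     (\<forall>j. 1 \<le> j \<and> j \<le> n \<longrightarrow>
        lower_bound r n x j \<le> x j \<and>
        x j \<le> upper_bound r n x j \<and>
        (x j = upper_bound r n x j \<longleftrightarrow>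
           x constant_on {1..j} \<and> x constant_on {j + 1..n}) \<and>
        (lower_bound r n x j = x j \<longleftrightarrow>
           x constant_on {1..j - 1} \<and> x constant_on {j..n}))"
proof -
  note ub = block_mean_le_upper_bound[OF assms(3) _ _ _ assms(2)]
  note lb = block_mean_ge_lower_bound[OF assms(3) _ _ _ assms(2)]
  have collapse: "lower_bound r n x 1 = arith_mean n x"
    using assms(2) by (simp add: lower_bound_def power_0_left)
  have single: "x constant_on {1..1}" "x constant_on {1 + 1..1}" "x constant_on {1..1 - 1}"
    by (auto simp: constant_on_def)
  have last: "x j = upper_bound r n x j \<longleftrightarrow> x constant_on {1..j} \<and> x constant_on {j + 1..n}"
    "lower_bound r n x j = x j \<longleftrightarrow> x constant_on {1..j - 1} \<and> x constant_on {j..n}"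
    if j: "1 \<le> j" "j \<le> n" for j
  proof -
    \<comment> \<open>Single entries are blocks with \<open>k = j\<close>. The excluded pair arises
      only for \<open>n = 1\<close>, where the bounds equal \<open>x 1\<close> and all constancy
      conditions are vacuous.\<close>
    consider "(j, j) \<noteq> (1, n)" | "j = 1" "n = 1"
      by auto
    then have "(x j = upper_bound r n x j \<longleftrightarrow> x constant_on {1..j} \<and> x constant_on {j + 1..n}) \<and>
      (lower_bound r n x j = x j \<longleftrightarrow> x constant_on {1..j - 1} \<and> x constant_on {j..n})"
    proof cases
      case 1
      then show ?thesis
        using ub(2)[of j j] lb(2)[of j j] j by (simp add: block_mean_singleton)
    next
      case 2
      then show ?thesis
        using collapse single upper_bound_at_n[OF assms(1,2), of x] block_mean_singleton[of 1 x]
        by (simp add: arith_mean_eq_block_mean)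
    qed
    then show "x j = upper_bound r n x j \<longleftrightarrow> x constant_on {1..j} \<and> x constant_on {j + 1..n}"
      "lower_bound r n x j = x j \<longleftrightarrow> x constant_on {1..j - 1} \<and> x constant_on {j..n}"
      by blast+
  qed
  show ?thesis
  proof (intro conjI allI impI; (elim conjE)?)
    fix j assume "1 \<le> j" "j \<le> n"
    then show "lower_bound r n x j \<le> x j" "x j \<le> upper_bound r n x j"
      using ub(1)[of j j] lb(1)[of j j] by (simp_all add: block_mean_singleton)
  qed (use ub lb last collapse upper_bound_at_n[OF assms(1,2), of x]
        in \<open>simp_all add: arith_mean_eq_block_mean\<close>)
qed

end
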